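(* (Well-balance of the fully discrete Runge-Kutta DG scheme.) Let $C_1,C_2$ be positive constants, $\Delta t_n=t_{n+1}-t_n$, and $b_h^{n+1}\in\mathcal V_h^k$. Let $U_h^n$ be the numerical solution at time $t_n$ on the old mesh, in the lake-at-rest steady state (with constants $C_1,C_2$) with respect to the bottom approximation on the old mesh, and assume that the interpolation of the solution to the new mesh $\mathcal T_h$ is well-balanced, i.e. that the interpolant $\tilde U_h^n=(\tilde h_h^n,\tilde m_h^n,\tilde w_h^n,\tilde\eta_h^n)^T\in(\mathcal V_h^k)^4$ satisfies on every element of $\mathcal T_h$ $$\tilde m_h^n=0,\qquad\tilde w_h^n=0,\qquad\tilde\eta_h^n=C_1\tilde h_h^n,\qquad\tilde h_h^n+b_h^{n+1}=C_2 .$$ Let $U_h^{(1)},U_h^{(2)},U_h^{n+1}\in(\mathcal V_h^k)^4$ be determined by the third-order strong stability preserving Runge-Kutta scheme: for all $K\in\mathcal T_h$ and all $\phi\in\mathcal V_h^k$, $$\int_KU_h^{(1)}\phi\,d\mathbf x=\int_K\tilde U_h^n\phi\,d\mathbf x+\Delta t_nR^*_{h,K}(\tilde U_h^n,b_h^{n+1},\phi),$$ $$\int_KU_h^{(2)}\phi\,d\mathbf x=\tfrac34\int_K\tilde U_h^n\phi\,d\mathbf x+\tfrac14\Big(\int_KU_h^{(1)}\phi\,d\mathbf x+\Delta t_nR^*_{h,K}(U_h^{(1)},b_h^{n+1},\phi)\Big),$$ $$\int_KU_h^{n+1}\phi\,d\mathbf x=\tfrac13\int_K\tilde U_h^n\phi\,d\mathbf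 x+\tfrac23\Big(\int_KU_h^{(2)}\phi\,d\mathbf x+\Delta t_nR^*_{h,K}(U_h^{(2)},b_h^{n+1},\phi)\Big),$$ where $R^*_{h,K}$ is defined in the context. Then $U_h^{n+1}=U_h^{(2)}=U_h^{(1)}=\tilde U_h^n$ on every element, and therefore $U_h^{n+1}=(h_h^{n+1},m_h^{n+1},w_h^{n+1},\eta_h^{n+1})^T$ is in the lake-at-rest steady state, $$m_h^{n+1}=0,\qquad w_h^{n+1}=0,\qquad\eta_h^{n+1}=C_1h_h^{n+1},\qquad h_h^{n+1}+b_h^{n+1}=C_2 ;$$ that is, the fully discrete scheme is well-balanced.
   Context: Ripa model: $\partial_tU+\nabla\cdot F(U)=S(U,b)$ in two space dimensions, $U=(h,m,w,\eta)^T=(h,hu,hv,h\theta)^T$, where $h\ge0$ is the water depth, $(u,v)$ the velocity, $\theta>0$ the potential temperature, $g$ the gravitational acceleration constant, $b$ the bottom topography, $$F(U)=\begin{bmatrix} m&w\\ \frac{m^2}{h}+\frac12 g\eta h&\frac{mw}{h}\\ \frac{mw}{h}&\frac{w^2}{h}+\frac12 g\eta h\\ \frac{m\eta}{h}&\frac{w\eta}{h}\end{bmatrix},\qquad S(U,b)=\begin{bmatrix}0\\-g\eta b_x\\-g\eta b_y\\0\end{bmatrix}.$$ The quotients $m/h$, $w/h$, $\eta/h$, here and below, stand for the velocity components $u,v$ and the temperature $\theta$; in the lake-at-rest state these are $u=0$, $v=0$, $\theta=C_1$. A discrete function $U_h=(h_h,m_h,w_h,\eta_h)^T$ is in the lake-at-rest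 steady state with respect to a bottom approximation $b_h$ if $m_h=0$, $w_h=0$, $\eta_h=C_1h_h$, $h_h+b_h=C_2$. $\mathcal T_h$ is a triangular mesh of a domain $\Omega\subset\mathbb R^2$ (the new mesh, at time $t_{n+1}$), $k$ a positive integer, and $\mathcal V_h^k=\{q\in L^2(\Omega): q|_K\in\mathbb P^k(K)\ \forall K\in\mathcal T_h\}$, where $\mathbb P^k(K)$ is the set of polynomials of degree up to $k$ on $K$. The function $b_h^{n+1}$ is a piecewise polynomial approximation of $b$ on $\mathcal T_h$, and $\tilde U_h^n$ is the numerical solution at time $t_n$ transferred to $\mathcal T_h$. In $S(U_h,b_h)$ derivatives of $b_h$ are taken elementwise. For an element $K$ with outward unit normal $\mathbf n_K=(n_x,n_y)^T$ and an edge $e_K\subset\partial K$, the superscript $int$ denotes the value on $e_K$ taken from inside $K$; $ext$ denotes the value from the neighbouring element sharing $e_K$ (for an edge on $\partial\Omega$, the exterior value supplied by the boundary treatment, which for a lake-at-rest solution satisfies the same lake-at-rest relations with the same $C_1,C_2$). The Lax-Friedrichs flux is $$\hat F(U^{int},U^{ext})=\tfrac12\Big(\big(F(U^{int})+F(U^{ext})\big)\cdot\mathbf n_K-\alpha_h(U^{ext}-U^{int})\Big),$$ where $\alpha_h$ is the maximum absolute value of the eigenvalues of the Jacobian matrices of $F(\cdot)\cdot\mathbf n_K$ at the interior and exterior values, taken over the edge or over all elements (the eigenvalues are $un_x+vn_y$ (double) and $un_x+vn_y\pm\sqrt{gh\theta}$). Hydrostatic reconstruction on $e_K$ (pointwise):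 $$b^*=\max(b_h^{int},b_h^{ext}),\quad h^{int,*}=\max(0,h_h^{int}+b_h^{int}-b^* ),\quad h^{ext,*}=\max(0,h_h^{ext}+b_h^{ext}-b^* ),$$ $$U^{int,*}=h^{int,*}\Big(1,\tfrac{m_h^{int}}{h_h^{int}},\tfrac{w_h^{int}}{h_h^{int}},\tfrac{\eta_h^{int}}{h_h^{int}}\Big)^T,\quad U^{ext,*}=h^{ext,*}\Big(1,\tfrac{m_h^{ext}}{h_h^{ext}},\tfrac{w_h^{ext}}{h_h^{ext}},\tfrac{\eta_h^{ext}}{h_h^{ext}}\Big)^T.$$ The modified flux is $$\hat F^*|_{e_K}=\hat F(U^{int,*},U^{ext,*})+\big(F(U_h^{int})-F(U^{int,*})\big)\cdot\mathbf n_K,$$ and the residual is $$R^*_{h,K}(U_h,b_h,\phi)=\int_KS(U_h,b_h)\phi\,d\mathbf x+\int_KF(U_h)\cdot\nabla\phi\,d\mathbf x-\sum_{e_K\subset\partial K}\int_{e_K}\hat F^*|_{e_K}\,\phi\,ds\ \in\mathbb R^4,$$ where on $e_K$ the test function $\phi$ takes its value from inside $K$. Integrals are understood exactly, and no slope or positivity limiters are applied in this statement. *)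

theory Defs
  imports "HOL-Analysis.Analysis"
begin

type_synonym point = "real^2"
type_synonym element = "point set"

(* A discrete function may jump across edges, so it carries one function per element:
   "q K x" is the value at x of the polynomial belonging to K. For x on an edge of K this is
   the trace from inside K. *)
type_synonym dg_scalar = "element \<Rightarrow> point \<Rightarrow> real"

(* components 1, 2, 3, 4 are h, m = h u, w = h v, eta = h theta *)
type_synonym state = "real^4"
type_synonym dg_state = "element \<Rightarrow> point \<Rightarrow> state"


subsection \<open>Mesh and discrete spaces\<close>

definition triangular_mesh :: "point set \<Rightarrow> element set \<Rightarrow> bool" where
  "triangular_mesh \<Omega> T \<longleftrightarrow>
     open \<Omega> \<and> connected \<Omega> \<and> \<Omega> \<noteq> {} \<and>
     triangulation T \<and> (\<forall>K\<in>T. 2 simplex K) \<and> \<Union>T = closure \<Omega>"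

definition polynomials_upto :: "nat \<Rightarrow> (point \<Rightarrow> real) set" where
  "polynomials_upto k =
     {p. \<exists>c :: nat \<Rightarrow> nat \<Rightarrow> real. \<forall>x. p x = (\<Sum>i\<le>k. \<Sum>j\<le>k - i. c i j * (x $ 1) ^ i * (x $ 2) ^ j)}"

(* Square integrability needs no separate clause: T is finite and its elements are compact. *)
definition dg_space :: "nat \<Rightarrow> element set \<Rightarrow> dg_scalar set" where
  "dg_space k T = {q. \<forall>K\<in>T. q K \<in> polynomials_upto k}"

definition dg_space4 :: "nat \<Rightarrow> element set \<Rightarrow> dg_state set" where
  "dg_space4 k T = {U. \<forall>i. (\<lambda>K x. U K x $ i) \<in> dg_space k T}"

definition grad :: "(point \<Rightarrow> real) \<Rightarrow> point \<Rightarrow> real^2" where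
  "grad f x = (\<chi> i. frechet_derivative f (at x) (axis i 1))"

definition outward_normal :: "element \<Rightarrow> point set \<Rightarrow> real^2" where
  "outward_normal K e = (THE n. norm n = 1 \<and> (\<forall>x\<in>e. \<forall>y\<in>K. n \<bullet> (y - x) \<le> 0))"

(* Arc length integral over a segment; it does not depend on which end point is called a. *)
definition edge_integral :: "point set \<Rightarrow> (point \<Rightarrow> state) \<Rightarrow> state" where
  "edge_integral e f =
     (let (a, b) = (SOME (a, b). e = closed_segment a b)
      in dist a b *\<^sub>R integral {0..1} (\<lambda>t. f (linepath a b t)))"

(* In a triangular mesh an edge not contained in the boundary of the domain has exactly one
   such neighbour. *)
definition neighbour :: "element set \<Rightarrow> element \<Rightarrow> point set \<Rightarrow> element" where
  "neighbour T K e = (SOME K'. K' \<in> T \<and> K' \<noteq> K \<and> e edge_of K')"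


subsection \<open>Ripa system\<close>

definition vel_x :: "state \<Rightarrow> real" where
  "vel_x U = U $ 2 / U $ 1"

definition vel_y :: "state \<Rightarrow> real" where
  "vel_y U = U $ 3 / U $ 1"

(* At dry points (h = 0) the quotients stand for the lake-at-rest values u = 0, v = 0,
   theta = C1. For the velocities this is the convention x / 0 = 0; the temperature needs the
   parameter \<theta>\<^sub>0. *)
definition temp :: "real \<Rightarrow> state \<Rightarrow> real" where
  "temp \<theta>\<^sub>0 U = (if U $ 1 = 0 then \<theta>\<^sub>0 else U $ 4 / U $ 1)"

definition ripa_flux :: "real \<Rightarrow> real \<Rightarrow> state \<Rightarrow> real^2^4" where
  "ripa_flux g \<theta>\<^sub>0 U =
     (let h = U $ 1; m = U $ 2; w = U $ 3; \<eta> = U $ 4 in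
      vector [vector [m, w],
              vector [m * vel_x U + g * \<eta> * h / 2, m * vel_y U],
              vector [m * vel_y U, w * vel_y U + g * \<eta> * h / 2],
              vector [m * temp \<theta>\<^sub>0 U, w * temp \<theta>\<^sub>0 U]])"

(* the second argument is the gradient of the bottom *)
definition ripa_source :: "real \<Rightarrow> state \<Rightarrow> real^2 \<Rightarrow> state" where
  "ripa_source g U db = vector [0, - g * U $ 4 * db $ 1, - g * U $ 4 * db $ 2, 0]"

(* eigenvalues of the Jacobian matrix of F(.) n; the first one is double *)
definition ripa_eigenvalues :: "real \<Rightarrow> real \<Rightarrow> state \<Rightarrow> real^2 \<Rightarrow> real set" where
  "ripa_eigenvalues g \<theta>\<^sub>0 U n =
     (let un = vel_x U * n $ 1 + vel_y U * n $ 2; c = sqrt (g * U $ 1 * temp \<theta>\<^sub>0 U)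
      in {un, un + c, un - c})"

definition max_speed :: "real \<Rightarrow> real \<Rightarrow> state \<Rightarrow> real^2 \<Rightarrow> real" where
  "max_speed g \<theta>\<^sub>0 U n = Max (abs ` ripa_eigenvalues g \<theta>\<^sub>0 U n)"

definition lake_at_rest_state :: "real \<Rightarrow> real \<Rightarrow> state \<Rightarrow> real \<Rightarrow> bool" where
  "lake_at_rest_state C1 C2 U b \<longleftrightarrow>
     U $ 2 = 0 \<and> U $ 3 = 0 \<and> U $ 4 = C1 * U $ 1 \<and> U $ 1 + b = C2"

definition lake_at_rest :: "real \<Rightarrow> real \<Rightarrow> element set \<Rightarrow> dg_state \<Rightarrow> dg_scalar \<Rightarrow> bool" where
  "lake_at_rest C1 C2 T U b \<longleftrightarrow> (\<forall>K\<in>T. \<forall>x\<in>K. lake_at_rest_state C1 C2 (U K x) (b K x))"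


subsection \<open>Exterior values and hydrostatic reconstruction\<close>

(* A boundary treatment turns a discrete solution and bottom into the exterior values of the
   state and the bottom, for an element K, an edge e of K on the boundary, and a point of e. *)
type_synonym boundary_treatment =
  "dg_state \<Rightarrow> dg_scalar \<Rightarrow> element \<Rightarrow> point set \<Rightarrow> point \<Rightarrow> state \<times> real"

definition exterior_values ::
  "point set \<Rightarrow> element set \<Rightarrow> boundary_treatment \<Rightarrow> dg_state \<Rightarrow> dg_scalar
   \<Rightarrow> element \<Rightarrow> point set \<Rightarrow> point \<Rightarrow> state \<times> real" where
  "exterior_values \<Omega> T bt U b K e x =
     (if e \<subseteq> frontier \<Omega> then bt U b K e x
      else (U (neighbour T K e) x, b (neighbour T K e) x))"

definition boundary_well_balanced ::
  "real \<Rightarrow> real \<Rightarrow> nat \<Rightarrow> point set \<Rightarrow> element set \<Rightarrow> boundary_treatment \<Rightarrow> dg_scalar \<Rightarrow> bool" where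
  "boundary_well_balanced C1 C2 k \<Omega> T bt b \<longleftrightarrow>
     (\<forall>U\<in>dg_space4 k T. lake_at_rest C1 C2 T U b \<longrightarrow>
        (\<forall>K\<in>T. \<forall>e. e edge_of K \<and> e \<subseteq> frontier \<Omega> \<longrightarrow>
           (\<forall>x\<in>e. lake_at_rest_state C1 C2 (fst (bt U b K e x)) (snd (bt U b K e x)))))"

definition reconstruct :: "real \<Rightarrow> state \<Rightarrow> real \<Rightarrow> real \<Rightarrow> state" where
  "reconstruct \<theta>\<^sub>0 U b bstar =
     max 0 (U $ 1 + b - bstar) *\<^sub>R vector [1, vel_x U, vel_y U, temp \<theta>\<^sub>0 U]"

definition reconstructed_values ::
  "real \<Rightarrow> point set \<Rightarrow> element set \<Rightarrow> boundary_treatment \<Rightarrow> dg_state \<Rightarrow> dg_scalar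
   \<Rightarrow> element \<Rightarrow> point set \<Rightarrow> point \<Rightarrow> state \<times> state" where
  "reconstructed_values \<theta>\<^sub>0 \<Omega> T bt U b K e x =
     (let (Uext, bext) = exterior_values \<Omega> T bt U b K e x;
          bstar = max (b K x) bext
      in (reconstruct \<theta>\<^sub>0 (U K x) (b K x) bstar, reconstruct \<theta>\<^sub>0 Uext bext bstar))"


subsection \<open>Numerical flux and residual\<close>

definition local_speed ::
  "real \<Rightarrow> real \<Rightarrow> point set \<Rightarrow> element set \<Rightarrow> boundary_treatment \<Rightarrow> dg_state \<Rightarrow> dg_scalar
   \<Rightarrow> element \<Rightarrow> point set \<Rightarrow> real" where
  "local_speed g \<theta>\<^sub>0 \<Omega> T bt U b K e =
     (SUP x\<in>e. let (Ui, Ue) = reconstructed_values \<theta>\<^sub>0 \<Omega> T bt U b K e x; n = outward_normal K e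
               in max (max_speed g \<theta>\<^sub>0 Ui n) (max_speed g \<theta>\<^sub>0 Ue n))"

definition global_speed ::
  "real \<Rightarrow> real \<Rightarrow> point set \<Rightarrow> element set \<Rightarrow> boundary_treatment \<Rightarrow> dg_state \<Rightarrow> dg_scalar \<Rightarrow> real" where
  "global_speed g \<theta>\<^sub>0 \<Omega> T bt U b =
     Max {local_speed g \<theta>\<^sub>0 \<Omega> T bt U b K e | K e. K \<in> T \<and> e edge_of K}"

datatype lf_variant = Local_LF | Global_LF

definition lf_speed ::
  "lf_variant \<Rightarrow> real \<Rightarrow> real \<Rightarrow> point set \<Rightarrow> element set \<Rightarrow> boundary_treatment \<Rightarrow> dg_state
   \<Rightarrow> dg_scalar \<Rightarrow> element \<Rightarrow> point set \<Rightarrow> real" where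
  "lf_speed var g \<theta>\<^sub>0 \<Omega> T bt U b K e =
     (case var of Local_LF \<Rightarrow> local_speed g \<theta>\<^sub>0 \<Omega> T bt U b K e
                | Global_LF \<Rightarrow> global_speed g \<theta>\<^sub>0 \<Omega> T bt U b)"

definition lax_friedrichs :: "real \<Rightarrow> real \<Rightarrow> real \<Rightarrow> real^2 \<Rightarrow> state \<Rightarrow> state \<Rightarrow> state" where
  "lax_friedrichs g \<theta>\<^sub>0 \<alpha> n Uint Uext =
     (1/2) *\<^sub>R ((ripa_flux g \<theta>\<^sub>0 Uint + ripa_flux g \<theta>\<^sub>0 Uext) *v n - \<alpha> *\<^sub>R (Uext - Uint))"

definition modified_flux ::
  "lf_variant \<Rightarrow> real \<Rightarrow> real \<Rightarrow> point set \<Rightarrow> element set \<Rightarrow> boundary_treatment \<Rightarrow> dg_state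
   \<Rightarrow> dg_scalar \<Rightarrow> element \<Rightarrow> point set \<Rightarrow> point \<Rightarrow> state" where
  "modified_flux var g \<theta>\<^sub>0 \<Omega> T bt U b K e x =
     (let (Ui, Ue) = reconstructed_values \<theta>\<^sub>0 \<Omega> T bt U b K e x;
          n = outward_normal K e
      in lax_friedrichs g \<theta>\<^sub>0 (lf_speed var g \<theta>\<^sub>0 \<Omega> T bt U b K e) n Ui Ue
         + (ripa_flux g \<theta>\<^sub>0 (U K x) - ripa_flux g \<theta>\<^sub>0 Ui) *v n)"

definition residual ::
  "lf_variant \<Rightarrow> real \<Rightarrow> real \<Rightarrow> point set \<Rightarrow> element set \<Rightarrow> boundary_treatment \<Rightarrow> element
   \<Rightarrow> dg_state \<Rightarrow> dg_scalar \<Rightarrow> dg_scalar \<Rightarrow> state" where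
  "residual var g \<theta>\<^sub>0 \<Omega> T bt K U b \<phi> =
     integral K (\<lambda>x. \<phi> K x *\<^sub>R ripa_source g (U K x) (grad (b K) x))
     + integral K (\<lambda>x. ripa_flux g \<theta>\<^sub>0 (U K x) *v grad (\<phi> K) x)
     - (\<Sum>e | e edge_of K. edge_integral e (\<lambda>x. \<phi> K x *\<^sub>R modified_flux var g \<theta>\<^sub>0 \<Omega> T bt U b K e x))"

definition moment :: "element \<Rightarrow> dg_state \<Rightarrow> dg_scalar \<Rightarrow> state" where
  "moment K U \<phi> = integral K (\<lambda>x. \<phi> K x *\<^sub>R U K x)"

end

theory Submission
  imports Defs
begin

text \<open>
  In a lake at rest the two hydrostatically reconstructed states on an edge coincide: both have
  depth \<open>max 0 (C2 - b*)\<close>, velocity zero and temperature \<open>C1\<close>, whatever the jump of the bottom.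
  So the dissipation term of the Lax-Friedrichs flux vanishes, for every wave speed, and by
  consistency the modified flux is the exact flux of the interior state
  (\<open>modified_flux_at_rest\<close>). On interior edges the exterior value is a genuine neighbour value,
  because every edge that is not contained in the boundary is shared by a second triangle
  (\<open>neighbour_exists\<close>).

  For zero momentum the flux reduces to the isotropic pressure \<open>g * C1 * h\<^sup>2 / 2\<close> in the two momentum
  equations. Since \<open>b = C2 - h\<close> inside a triangle, the source is the gradient of this pressure, and
  the two volume integrals of the residual add up to the integral of the gradient of pressure
  times test function. This equals the sum of the edge integrals by the divergence theorem on a
  triangle (\<open>divergence_triangle\<close>), so the residual is zero (\<open>residual_at_rest\<close>).

  A Runge-Kutta stage whose residuals vanish is a convex combination of equal moments. A stage has
  therefore the same moments against all test functions as the initial state, and testing with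
  the difference of the two functions shows that they agree (\<open>moments_determine\<close>). In particular the
  stage is again at rest, and the argument repeats for the next one.
\<close>

section \<open>Integration over a triangle\<close>

lemma vector_2_measurable [measurable]:
  "(\<lambda>p :: real \<times> real. vector [fst p, snd p] :: real^2) \<in> borel_measurable borel"
proof -
  have "(\<lambda>p :: real \<times> real. vector [fst p, snd p] :: real^2)
      = (\<lambda>p. fst p *\<^sub>R axis 1 1 + snd p *\<^sub>R axis 2 1)"
    by (auto simp: vec_eq_iff forall_2 axis_def)
  moreover have "\<dots> \<in> borel_measurable borel"
    by (intro borel_measurable_continuous_onI continuous_intros)
  ultimately show ?thesis by simp
qed

lemma Basis_plane: "(Basis :: (real^2) set) = {axis 1 1, axis 2 1}"
  by (auto simp: Basis_vec_def UNIV_2)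

text \<open>This identification turns integrals over the plane into integrals over a product of two lines,
  to which Fubini's theorem applies.\<close>
lemma lborel_plane:
  "distr (lborel \<Otimes>\<^sub>M lborel) borel (\<lambda>p. vector [fst p, snd p]) = (lborel :: (real^2) measure)"
proof (rule lborel_eqI [symmetric])
  fix l u :: "real^2"
  assume le: "\<And>i. i \<in> Basis \<Longrightarrow> l \<bullet> i \<le> u \<bullet> i"
  have l: "l $ 1 \<le> u $ 1" "l $ 2 \<le> u $ 2"
    using le[of "axis 1 1"] le[of "axis 2 1"] by (auto simp: Basis_plane inner_axis)
  have "(\<lambda>p :: real \<times> real. vector [fst p, snd p] :: real^2) -` box l u
      = {l$1 <..< u$1} \<times> {l$2 <..< u$2}"
    by (auto simp: mem_box_cart forall_2)
  then have "emeasure (distr (lborel \<Otimes>\<^sub>M lborel) borel (\<lambda>p :: real \<times> real. vector [fst p, snd p] :: real^2)) (box l u)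
      = emeasure (lborel \<Otimes>\<^sub>M lborel) ({l$1 <..< u$1} \<times> {l$2 <..< u$2})"
    by (subst emeasure_distr) (auto simp: lborel_prod space_pair_measure)
  also have "\<dots> = ennreal (u$1 - l$1) * ennreal (u$2 - l$2)"
    using l by (subst lborel.emeasure_pair_measure_Times) auto
  also have "\<dots> = ennreal (\<Prod>b\<in>Basis. (u - l) \<bullet> b)"
    using l by (simp add: Basis_plane axis_eq_axis inner_axis ennreal_mult)
  finally show "emeasure (distr (lborel \<Otimes>\<^sub>M lborel) borel (\<lambda>p :: real \<times> real. vector [fst p, snd p] :: real^2)) (box l u)
      = ennreal (\<Prod>b\<in>Basis. (u - l) \<bullet> b)" .
qed simp

definition std_triangle :: "point set" where
  "std_triangle = {x. 0 \<le> x $ 1 \<and> 0 \<le> x $ 2 \<and> x $ 1 + x $ 2 \<le> 1}"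

lemma compact_std_triangle: "compact std_triangle"
proof -
  have "std_triangle \<subseteq> cbox 0 1"
    by (auto simp: std_triangle_def mem_box_cart forall_2)
  then have "bounded std_triangle"
    using bounded_cbox bounded_subset by blast
  moreover have "closed std_triangle"
    unfolding std_triangle_def
    by (intro closed_Collect_conj closed_Collect_le continuous_intros)
  ultimately show ?thesis
    using compact_eq_bounded_closed by blast
qed

lemma integral_std_triangle:
  fixes G :: "point \<Rightarrow> real"
  assumes "continuous_on UNIV G"
  shows "integral std_triangle G
       = integral {0..1} (\<lambda>s. integral {0..1 - s} (\<lambda>t. G (vector [s, t])))"
proof -
  let ?v = "\<lambda>p :: real \<times> real. vector [fst p, snd p] :: real^2"
  let ?G = "\<lambda>x. indicator std_triangle x *\<^sub>R G x"
  have int: "integrable lborel ?G"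
    using assms borel_integrable_compact compact_std_triangle continuous_on_subset by blast
  have meas: "?v \<in> measurable (lborel \<Otimes>\<^sub>M lborel) borel"
    by (simp add: lborel_prod)
  have Gm: "?G \<in> borel_measurable borel"
    using int by auto
  have intp: "integrable (lborel \<Otimes>\<^sub>M lborel) (\<lambda>p. ?G (?v p))"
    using integrable_distr[OF meas, of ?G] int by (simp add: lborel_plane)
  have cont: "continuous_on A (\<lambda>t. G (vector [s, t]))" for s A
  proof -
    have "(\<lambda>t. vector [s, t] :: real^2) = (\<lambda>t. s *\<^sub>R axis 1 1 + t *\<^sub>R axis 2 1)"
      by (auto simp: vec_eq_iff forall_2 axis_def)
    then have "continuous_on A (\<lambda>t. vector [s, t] :: real^2)"
      by (simp only:) (intro continuous_intros)
    then show ?thesis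
      using assms continuous_on_compose2 by (metis top_greatest)
  qed
  have inner: "(LBINT t. ?G (vector [s, t]))
             = indicator {0..1} s *\<^sub>R integral {0..1 - s} (\<lambda>t. G (vector [s, t]))" for s
  proof (cases "s \<in> {0..1}")
    case True
    then have "(LBINT t. ?G (vector [s, t])) = (LBINT t:{0..1-s}. G (vector [s, t]))"
      unfolding set_lebesgue_integral_def
      by (intro Bochner_Integration.integral_cong) (auto simp: std_triangle_def indicator_def)
    also have "\<dots> = integral {0..1 - s} (\<lambda>t. G (vector [s, t]))"
      by (intro set_borel_integral_eq_integral)
         (unfold set_integrable_def, intro borel_integrable_compact cont, simp)
    finally show ?thesis using True by simp
  next
    case False
    then have z: "?G (vector [s, t]) = 0" for t
      by (auto simp: std_triangle_def indicator_def)
    show ?thesis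
      unfolding z using False by simp
  qed
  have "integral std_triangle G = (LBINT x:std_triangle. G x)"
    using int by (intro set_borel_integral_eq_integral(2) [symmetric]) (simp add: set_integrable_def)
  also have "\<dots> = (\<integral>x. ?G x \<partial>distr (lborel \<Otimes>\<^sub>M lborel) borel ?v)"
    by (simp add: set_lebesgue_integral_def lborel_plane)
  also have "\<dots> = (\<integral>p. ?G (?v p) \<partial>(lborel \<Otimes>\<^sub>M lborel))"
    using meas Gm by (rule integral_distr)
  also have "\<dots> = (LBINT s. LBINT t. ?G (vector [s, t]))"
    using lborel_pair.integral_fst'[OF intp] by simp
  also have "\<dots> = (LBINT s:{0..1}. integral {0..1 - s} (\<lambda>t. G (vector [s, t])))"
    unfolding inner set_lebesgue_integral_def ..
  also have "\<dots> = integral {0..1} (\<lambda>s. integral {0..1 - s} (\<lambda>t. G (vector [s, t])))"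
  proof (intro set_borel_integral_eq_integral)
    show "set_integrable lborel {0..1} (\<lambda>s. integral {0..1 - s} (\<lambda>t. G (vector [s, t])))"
      using lborel_pair.integrable_fst'[OF intp] unfolding fst_conv snd_conv inner set_integrable_def .
  qed
  finally show ?thesis .
qed

text \<open>The determinant of the affine map that takes the standard triangle to the triangle \<open>a b c\<close>.
  It is positive for counterclockwise vertices.\<close>
definition signed_area2 :: "point \<Rightarrow> point \<Rightarrow> point \<Rightarrow> real" where
  "signed_area2 a b c = (b - a) $ 1 * (c - a) $ 2 - (b - a) $ 2 * (c - a) $ 1"

lemma integral_triangle:
  fixes G :: "point \<Rightarrow> real"
  assumes G: "continuous_on UNIV G" and nz: "signed_area2 a b c \<noteq> 0"
  shows "integral (convex hull {a, b, c}) G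
    = \<bar>signed_area2 a b c\<bar> * integral {0..1} (\<lambda>s. integral {0..1 - s} (\<lambda>t. G (a + s *\<^sub>R (b - a) + t *\<^sub>R (c - a))))"
proof -
  define A where "A = (\<lambda>x :: real^2. a + x $ 1 *\<^sub>R (b - a) + x $ 2 *\<^sub>R (c - a))"
  define L where "L = (\<lambda>x :: real^2. x $ 1 *\<^sub>R (b - a) + x $ 2 *\<^sub>R (c - a))"
  have der: "(A has_derivative L) (at x within S)" for x S
    unfolding A_def L_def
    by (auto intro!: derivative_eq_intros bounded_linear_imp_has_derivative bounded_linear_vec_nth)
  have det: "det (matrix L) = signed_area2 a b c"
    by (simp add: det_2 matrix_def L_def axis_def signed_area2_def)
  have inj: "inj_on A std_triangle"
  proof (rule inj_onI)
    fix x y assume "A x = A y"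
    then have "L (x - y) = 0"
      by (simp add: A_def L_def algebra_simps)
    moreover have "linear L"
      using der has_derivative_linear by blast
    ultimately have "x - y = 0"
      using det nz det_nz_iff_inj by (metis linear_injective_0)
    then show "x = y" by simp
  qed
  have img: "A ` std_triangle = convex hull {a, b, c}"
  proof -
    have "a + u *\<^sub>R (b - a) + v *\<^sub>R (c - a) \<in> A ` std_triangle" if "0 \<le> u" "0 \<le> v" "u + v \<le> 1" for u v
      using that by (intro image_eqI[of _ _ "vector [u, v]"]) (auto simp: A_def std_triangle_def)
    then show ?thesis
      unfolding convex_hull_3_alt by (auto simp: A_def std_triangle_def)
  qed
  have contA: "continuous_on S A" for S
    unfolding A_def by (intro continuous_intros)
  have contGA: "continuous_on UNIV (\<lambda>x. G (A x))"
    using G contA continuous_on_compose2 by blast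
  \<comment> \<open>The change of variables theorem takes integrands with values in a cartesian space.\<close>
  let ?H = "\<lambda>x. vec (G x) :: real^1"
  have vecL: "integral S (\<lambda>x. vec (h x) :: real^1) $ 1 = integral S h" 
    if "(\<lambda>x. vec (h x) :: real^1) integrable_on S" for S and h :: "point \<Rightarrow> real"
    using that by (simp add: integral_component_eq_cart [symmetric])
  have abs: "(\<lambda>x. vec (h x) :: real^1) absolutely_integrable_on S"
    if "continuous_on UNIV h" "compact S" for S and h :: "point \<Rightarrow> real"
  proof -
    have "continuous_on S (\<lambda>x. vec (h x) :: real^1)"
      unfolding vec_def using that by (auto intro!: continuous_intros intro: continuous_on_subset)
    then have "integrable lborel (\<lambda>x. indicator S x *\<^sub>R (vec (h x) :: real^1))"
      by (rule borel_integrable_compact[OF \<open>compact S\<close>])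
    then show ?thesis
      unfolding set_integrable_def
      by (subst integrable_completion) (auto dest: borel_measurable_integrable)
  qed
  have cK: "compact (convex hull {a, b, c})"
    by (simp add: finite_imp_compact_convex_hull)
  have "integral std_triangle (\<lambda>x. \<bar>det (matrix L)\<bar> *\<^sub>R ?H (A x)) = integral (convex hull {a, b, c}) ?H"
    using has_absolute_integral_change_of_variables_compact[OF compact_std_triangle der inj, of ?H]
      abs[OF G cK] by (auto simp: img)
  then have "\<bar>signed_area2 a b c\<bar> *\<^sub>R integral std_triangle (\<lambda>x. ?H (A x)) = integral (convex hull {a, b, c}) ?H"
    by (simp add: det)
  then have "\<bar>signed_area2 a b c\<bar> * integral std_triangle (\<lambda>x. ?H (A x)) $ 1 = integral (convex hull {a, b, c}) ?H $ 1"
    by (metis scaleR_conv_of_real vector_scaleR_component real_scaleR_def)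
  then have "\<bar>signed_area2 a b c\<bar> * integral std_triangle (\<lambda>x. G (A x)) = integral (convex hull {a, b, c}) G"
    using vecL[of "\<lambda>x. G (A x)" std_triangle] vecL[of G "convex hull {a, b, c}"]
      abs[OF contGA compact_std_triangle] abs[OF G cK]
    by (auto simp: absolutely_integrable_on_def)
  then show ?thesis
    unfolding integral_std_triangle[OF contGA] by (simp add: A_def)
qed

text \<open>A derivative along one side becomes a partial derivative in the affine parametrisation that
  starts at the end point \<open>a\<close> of this side. The inner integral is then evaluated by the fundamental
  theorem of calculus, which leaves the integrals over the other two sides.\<close>
lemma integral_triangle_directional:
  fixes f :: "point \<Rightarrow> real" and G :: "point \<Rightarrow> real^2"
  assumes der: "\<And>x. (f has_derivative (\<lambda>v. G x \<bullet> v)) (at x)"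
    and G: "continuous_on UNIV G" and nz: "signed_area2 a b c \<noteq> 0"
  shows "integral (convex hull {a, b, c}) (\<lambda>x. G x \<bullet> (c - a))
       = \<bar>signed_area2 a b c\<bar>
         * (integral {0..1} (\<lambda>t. f (linepath c b t)) - integral {0..1} (\<lambda>t. f (linepath a b t)))"
proof -
  have f: "continuous_on S f" for S
    by (meson der has_derivative_continuous_on has_derivative_at_withinI)
  have inner: "integral {0..1 - s} (\<lambda>t. G (a + s *\<^sub>R (b - a) + t *\<^sub>R (c - a)) \<bullet> (c - a))
             = f (linepath c b s) - f (linepath a b s)" if "s \<in> {0..1}" for s
  proof -
    have "((\<lambda>t. f (a + s *\<^sub>R (b - a) + t *\<^sub>R (c - a))) has_vector_derivative
            G (a + s *\<^sub>R (b - a) + t *\<^sub>R (c - a)) \<bullet> (c - a)) (at t within {0..1 - s})" for t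
    proof -
      have "((\<lambda>t. a + s *\<^sub>R (b - a) + t *\<^sub>R (c - a)) has_derivative (\<lambda>h. h *\<^sub>R (c - a))) (at t within {0..1 - s})"
        by (auto intro!: derivative_eq_intros)
      from has_derivative_compose[OF this der] show ?thesis
        by (simp add: has_vector_derivative_def)
    qed
    then have "((\<lambda>t. G (a + s *\<^sub>R (b - a) + t *\<^sub>R (c - a)) \<bullet> (c - a)) has_integral
        f (a + s *\<^sub>R (b - a) + (1 - s) *\<^sub>R (c - a)) - f (a + s *\<^sub>R (b - a) + 0 *\<^sub>R (c - a))) {0..1 - s}"
      using that by (intro fundamental_theorem_of_calculus) auto
    moreover have "a + s *\<^sub>R (b - a) + (1 - s) *\<^sub>R (c - a) = linepath c b s"
      "a + s *\<^sub>R (b - a) + 0 *\<^sub>R (c - a) = linepath a b s"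
      by (simp_all add: linepath_def algebra_simps)
    ultimately show ?thesis by (metis integral_unique)
  qed
  have ig: "(\<lambda>t. f (linepath p q t)) integrable_on {0..1}" for p q
    by (intro integrable_continuous_real continuous_on_compose2[OF f[of UNIV] continuous_on_linepath]) auto
  have "integral (convex hull {a, b, c}) (\<lambda>x. G x \<bullet> (c - a))
      = \<bar>signed_area2 a b c\<bar> * integral {0..1} (\<lambda>s. f (linepath c b s) - f (linepath a b s))"
    by (subst integral_triangle[OF _ nz])
       (auto intro!: continuous_intros G integral_cong simp: inner)
  then show ?thesis
    by (simp add: integral_diff[OF ig ig])
qed

section \<open>The divergence theorem on a triangle\<close>

lemma signed_area2_rotate: "signed_area2 b c a = signed_area2 a b c"
  and signed_area2_swap: "signed_area2 a c b = - signed_area2 a b c"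
  by (simp_all add: signed_area2_def algebra_simps)

lemma orthogonal_to_two_imp_zero:
  fixes x u v :: "real^2"
  assumes "x \<bullet> u = 0" "x \<bullet> v = 0" "u $ 1 * v $ 2 - u $ 2 * v $ 1 \<noteq> 0"
  shows "x = 0"
proof -
  have "x $ 1 * (u $ 1 * v $ 2 - u $ 2 * v $ 1) = v $ 2 * (x \<bullet> u) - u $ 2 * (x \<bullet> v)"
    "x $ 2 * (u $ 1 * v $ 2 - u $ 2 * v $ 1) = u $ 1 * (x \<bullet> v) - v $ 1 * (x \<bullet> u)"
    by (simp_all add: inner_vec_def sum_2 algebra_simps)
  then show ?thesis
    using assms by (simp add: vec_eq_iff forall_2)
qed

text \<open>By Lagrange's identity a vanishing area is the equality case of the Cauchy-Schwarz
  inequality.\<close>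
lemma signed_area2_nonzero:
  assumes "\<not> affine_dependent {a, b, c}" "card {a, b, c} = 3"
  shows "signed_area2 a b c \<noteq> 0"
proof
  assume 0: "signed_area2 a b c = 0"
  define d w where "d = b - a" and "w = c - a"
  have "(d \<bullet> w)\<^sup>2 + (signed_area2 a b c)\<^sup>2 = (d \<bullet> d) * (w \<bullet> w)"
    by (simp add: signed_area2_def d_def w_def inner_vec_def sum_2 power2_eq_square algebra_simps)
  then have "(d \<bullet> w)\<^sup>2 = (norm d * norm w)\<^sup>2"
    using 0 by (simp add: power_mult_distrib power2_norm_eq_inner)
  then have "\<bar>d \<bullet> w\<bar> = norm d * norm w"
    by (metis abs_mult abs_norm_cancel power2_eq_iff_nonneg power2_abs abs_ge_zero)
  then have "collinear {0, d, w}"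
    by (simp add: norm_cauchy_schwarz_equal)
  then have "collinear {b, a, c}"
    using collinear_3[of b a c] by (simp add: d_def w_def)
  moreover have "a \<noteq> b" "a \<noteq> c" "b \<noteq> c"
    using assms(2) by (auto simp: card_insert_if split: if_splits)
  ultimately show False
    using assms(1) by (auto simp: collinear_3_eq_affine_dependent insert_commute)
qed

text \<open>The normal is the edge vector turned by a right angle, with the sign that points away from
  the opposite vertex \<open>r\<close>. The second equation is base times height and does not depend on the
  orientation of the triangle, so the three edges can be treated alike.\<close>
lemma outward_normal_triangle:
  assumes nz: "signed_area2 p q r \<noteq> 0"
  defines "n \<equiv> outward_normal (convex hull {p, q, r}) (closed_segment p q)"
  shows "n \<bullet> (q - p) = 0" and "dist p q * (n \<bullet> (r - p)) = - \<bar>signed_area2 p q r\<bar>"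
proof -
  define d w where "d = q - p" and "w = r - p"
  define s where "s = signed_area2 p q r"
  define rot where "rot = (vector [- d $ 2, d $ 1] :: real^2)"
  define n0 where "n0 = (- sgn s / norm d) *\<^sub>R rot"
  have s: "s = d $ 1 * w $ 2 - d $ 2 * w $ 1"
    by (simp add: s_def signed_area2_def d_def w_def)
  have d0: "d \<noteq> 0" using nz s unfolding s_def by auto
  have dd: "(norm d)\<^sup>2 = (d $ 1)\<^sup>2 + (d $ 2)\<^sup>2"
    unfolding power2_norm_eq_inner inner_vec_def sum_2 by (simp add: power2_eq_square)
  have rot: "rot \<bullet> d = 0" "rot \<bullet> w = s" "norm rot = norm d"
    by (simp_all add: rot_def inner_vec_def sum_2 s norm_eq_sqrt_inner add.commute)
  have n0: "n0 \<bullet> d = 0" "norm d * (n0 \<bullet> w) = - \<bar>s\<bar>" "norm n0 = 1"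
    using d0 nz rot by (auto simp: n0_def s_def abs_sgn algebra_simps abs_sgn_eq)
  have "n = n0"
    unfolding n_def outward_normal_def
  proof (rule the_equality, intro conjI ballI)
    show "norm n0 = 1" by (fact n0)
    fix x y assume "x \<in> closed_segment p q" "y \<in> convex hull {p, q, r}"
    then obtain u v t where x: "x = (1 - t) *\<^sub>R p + t *\<^sub>R q"
      and y: "y = p + u *\<^sub>R (q - p) + v *\<^sub>R (r - p)" "0 \<le> v"
      unfolding convex_hull_3_alt in_segment by auto
    have "y - x = (u - t) *\<^sub>R d + v *\<^sub>R w"
      unfolding x y by (simp add: d_def w_def algebra_simps)
    then have "n0 \<bullet> (y - x) = v * (n0 \<bullet> w)"
      by (simp add: inner_add_right n0)
    moreover have "n0 \<bullet> w \<le> 0"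
      using n0(2) d0 by (smt (verit) mult_pos_pos zero_less_norm_iff)
    ultimately show "n0 \<bullet> (y - x) \<le> 0"
      using y(2) by (simp add: mult_nonneg_nonpos)
  next
    fix n' assume n': "norm n' = 1 \<and> (\<forall>x\<in>closed_segment p q. \<forall>y\<in>convex hull {p, q, r}. n' \<bullet> (y - x) \<le> 0)"
    have mem: "p \<in> convex hull {p, q, r}" "q \<in> convex hull {p, q, r}" "r \<in> convex hull {p, q, r}"
      by (auto intro: hull_inc)
    have "n' \<bullet> (q - p) \<le> 0" "n' \<bullet> (p - q) \<le> 0" and w: "n' \<bullet> w \<le> 0"
      using n' mem by (auto simp: w_def)
    then have d: "n' \<bullet> d = 0"
      by (simp add: d_def inner_diff_right)
    define \<kappa> where "\<kappa> = (n' \<bullet> rot) / (norm d)\<^sup>2"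
    have "(norm d)\<^sup>2 *\<^sub>R n' = (n' \<bullet> rot) *\<^sub>R rot"
    proof -
      have "n' $ 1 * d $ 1 + n' $ 2 * d $ 2 = 0"
        using d by (simp add: inner_vec_def sum_2)
      then have "(norm d)\<^sup>2 * n' $ 1 = (n' \<bullet> rot) * rot $ 1" "(norm d)\<^sup>2 * n' $ 2 = (n' \<bullet> rot) * rot $ 2"
        unfolding dd rot_def by (simp_all add: inner_vec_def sum_2 power2_eq_square) algebra+
      then show ?thesis by (simp add: vec_eq_iff forall_2)
    qed
    then have "(1 / (norm d)\<^sup>2) *\<^sub>R ((norm d)\<^sup>2 *\<^sub>R n') = \<kappa> *\<^sub>R rot"
      by (simp add: \<kappa>_def)
    then have \<kappa>: "n' = \<kappa> *\<^sub>R rot"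
      using d0 by simp
    then have "\<bar>\<kappa>\<bar> = 1 / norm d"
      using n' rot(3) d0 by (simp add: field_simps)
    moreover have "\<kappa> * s \<le> 0"
      using w rot(2) by (simp add: \<kappa>)
    ultimately have "\<kappa> = - sgn s / norm d"
      using nz unfolding s_def[symmetric]
      by (cases "s > 0") (auto simp: mult_le_0_iff sgn_if abs_if split: if_splits)
    then show "n' = n0" by (simp add: \<kappa> n0_def)
  qed
  then show "n \<bullet> (q - p) = 0" "dist p q * (n \<bullet> (r - p)) = - \<bar>signed_area2 p q r\<bar>"
    using n0 by (simp_all add: d_def w_def s_def dist_norm norm_minus_commute)
qed

lemma integral_linepath_commute:
  fixes f :: "'a::real_normed_vector \<Rightarrow> 'b::euclidean_space"
  shows
  "integral {0..1} (\<lambda>t. f (linepath b a t)) = integral {0..1} (\<lambda>t. f (linepath a b t))"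
proof -
  have "integral {0..1} (\<lambda>t. f (linepath a b t)) = integral {-1..0} (\<lambda>t. f (linepath a b (- t)))"
    using Henstock_Kurzweil_Integration.integral_reflect_real[of 1 0 "\<lambda>t. f (linepath a b t)"] by simp
  also have "\<dots> = integral {0..1} (\<lambda>t. f (linepath a b (- (t + - 1))))"
    using integral_shift_real_ivl[of "-1" "-1" 0 "\<lambda>t. f (linepath a b (- t))"] by simp
  also have "(\<lambda>t. linepath a b (- (t + - 1))) = linepath b a"
    by (auto simp: linepath_def)
  then have "(\<lambda>t. f (linepath a b (- (t + - 1)))) = (\<lambda>t. f (linepath b a t))"
    by metis
  finally show ?thesis by simp
qed

text \<open>The end points chosen in the definition can only be \<open>a\<close> and \<open>b\<close> in some order, and reversing
  a segment does not change the integral.\<close>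
lemma edge_integral_segment:
  "edge_integral (closed_segment a b) f = dist a b *\<^sub>R integral {0..1} (\<lambda>t. f (linepath a b t))"
proof -
  define P where "P = (\<lambda>(p, q). closed_segment a b = closed_segment p q)"
  obtain p q where pq: "(SOME x. P x) = (p, q)" by fastforce
  have "P (SOME x. P x)"
    by (rule someI[of P "(a, b)"]) (simp add: P_def)
  then have "{a, b} = {p, q}"
    unfolding pq by (simp add: P_def)
  then have "a = p \<and> b = q \<or> a = q \<and> b = p"
    by (auto simp: doubleton_eq_iff)
  then show ?thesis
    using pq integral_linepath_commute[of f a b]
    by (auto simp: edge_integral_def P_def dist_commute)
qed

lemma edges_of_triangle:
  fixes a b c :: point
  assumes ind: "\<not> affine_dependent {a, b, c}" and card: "card {a, b, c} = 3"
  shows "{e. e edge_of (convex hull {a, b, c})} = {closed_segment a b, closed_segment b c, closed_segment c a}"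
proof -
  have ne: "a \<noteq> b" "a \<noteq> c" "b \<noteq> c"
    using card by (auto simp: card_insert_if split: if_splits)
  have dim: "aff_dim (convex hull S) = int (card S) - 1" if "S \<subseteq> {a, b, c}" for S
  proof -
    have "\<not> affine_dependent S"
      using affine_dependent_subset[OF _ that] ind by blast
    then show ?thesis
      by (simp add: aff_dim_convex_hull aff_dim_affine_independent)
  qed
  have two: "card S = 2 \<longleftrightarrow> S = {a, b} \<or> S = {b, c} \<or> S = {c, a}" if "S \<subseteq> {a, b, c}" for S
  proof -
    have "S \<in> Pow {a, b, c}" using that by simp
    then have "S = {} \<or> S = {a} \<or> S = {b} \<or> S = {c} \<or> S = {a, b} \<or> S = {a, c} \<or> S = {b, c} \<or> S = {a, b, c}"
      by (simp add: Pow_insert) blast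
    moreover have "{a, b, c} \<noteq> {a, b}" "{a, b, c} \<noteq> {b, c}" "{a, b, c} \<noteq> {c, a}"
    proof -
      have "card {a, b} = 2" "card {b, c} = 2" "card {c, a} = 2" "(3::nat) \<noteq> 2"
        using ne by simp_all
      then show "{a, b, c} \<noteq> {a, b}" "{a, b, c} \<noteq> {b, c}" "{a, b, c} \<noteq> {c, a}"
        using card by metis+
    qed
    ultimately show ?thesis
      using ne card by (elim disjE) (simp_all add: doubleton_eq_iff insert_commute[of a c])
  qed
  have "e edge_of (convex hull {a, b, c}) \<longleftrightarrow> (\<exists>S. S \<subseteq> {a, b, c} \<and> card S = 2 \<and> e = convex hull S)" for e
    unfolding edge_of_def face_of_convex_hull_affine_independent[OF ind]
  proof
    assume "(\<exists>S\<subseteq>{a, b, c}. e = convex hull S) \<and> aff_dim e = 1"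
    then obtain S where "S \<subseteq> {a, b, c}" "e = convex hull S" "aff_dim (convex hull S) = 1"
      by blast
    then show "\<exists>S. S \<subseteq> {a, b, c} \<and> card S = 2 \<and> e = convex hull S"
      using dim[of S] by (intro exI[of _ S]) simp
  next
    assume "\<exists>S. S \<subseteq> {a, b, c} \<and> card S = 2 \<and> e = convex hull S"
    then obtain S where "S \<subseteq> {a, b, c}" "card S = 2" "e = convex hull S"
      by blast
    then show "(\<exists>S\<subseteq>{a, b, c}. e = convex hull S) \<and> aff_dim e = 1"
      using dim[of S] by auto
  qed
  then have "{e. e edge_of (convex hull {a, b, c})} = (hull) convex ` {S. S \<subseteq> {a, b, c} \<and> card S = 2}"
    unfolding image_def by simp
  also have "{S. S \<subseteq> {a, b, c} \<and> card S = 2} = {{a, b}, {b, c}, {c, a}}"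
  proof (rule set_eqI)
    fix S
    show "S \<in> {S. S \<subseteq> {a, b, c} \<and> card S = 2} \<longleftrightarrow> S \<in> {{a, b}, {b, c}, {c, a}}"
      using two[of S] by (cases "S \<subseteq> {a, b, c}") (simp_all, fast?)
  qed
  finally show ?thesis by (simp add: segment_convex_hull)
qed

text \<open>The integral of \<open>G\<close> and the boundary term are vectors of the plane. They are compared by their
  inner products with the two sides at \<open>a\<close>: on the left these are directional derivatives, on the
  right one edge drops out because it is orthogonal to its normal. The linear map \<open>L\<close> embeds the
  plane into the state space.\<close>
theorem divergence_triangle:
  fixes f :: "point \<Rightarrow> real" and G :: "point \<Rightarrow> real^2" and L :: "real^2 \<Rightarrow> state"
  assumes der: "\<And>x. (f has_derivative (\<lambda>v. G x \<bullet> v)) (at x)"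
    and G: "continuous_on UNIV G" and L: "linear L" and K: "2 simplex K"
  shows "integral K (\<lambda>x. L (G x))
       = (\<Sum>e | e edge_of K. edge_integral e (\<lambda>x. f x *\<^sub>R L (outward_normal K e)))"
proof -
  obtain C where C: "\<not> affine_dependent C" "card C = 3" "K = convex hull C"
    using K by (auto simp: simplex_def)
  then obtain a b c where abc: "C = {a, b, c}"
    by (auto simp: card_3_iff)
  have ne: "a \<noteq> b" "a \<noteq> c" "b \<noteq> c"
    using C(2) unfolding abc by (auto simp: card_insert_if split: if_splits)
  have K_eq: "K = convex hull {a, b, c}" using C abc by simp
  define s where "s = \<bar>signed_area2 a b c\<bar>"
  have nz: "signed_area2 a b c \<noteq> 0"
    using signed_area2_nonzero C abc by blast
  define I where "I = (\<lambda>p q. integral {0..1} (\<lambda>t. f (linepath p q t)))"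
  have I_commute: "I q p = I p q" for p q
    unfolding I_def by (rule integral_linepath_commute)
  define n where "n = (\<lambda>p q. outward_normal K (closed_segment p q))"
  define N where "N = (dist a b * I a b) *\<^sub>R n a b + (dist b c * I b c) *\<^sub>R n b c + (dist c a * I c a) *\<^sub>R n c a"
  have lin: "bounded_linear L" using L linear_conv_bounded_linear by blast
  have f: "continuous_on S f" for S
    by (meson der has_derivative_continuous_on has_derivative_at_withinI)
  have edge: "edge_integral (closed_segment p q) (\<lambda>x. f x *\<^sub>R L (outward_normal K (closed_segment p q)))
            = L ((dist p q * I p q) *\<^sub>R n p q)" for p q
  proof -
    have "(\<lambda>t. f (linepath p q t)) integrable_on {0..1}"
      by (intro integrable_continuous_real continuous_on_compose2[OF f[of UNIV] continuous_on_linepath]) auto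
    then have "integral {0..1} (\<lambda>t. f (linepath p q t) *\<^sub>R L (n p q)) = I p q *\<^sub>R L (n p q)"
      unfolding I_def
      using integral_linear[OF _ bounded_linear_scaleR_left, of "\<lambda>t. f (linepath p q t)" "{0..1}" "L (n p q)"]
      by (simp add: o_def)
    then show ?thesis
      by (simp add: edge_integral_segment n_def linear_scale[OF L])
  qed
  have Gint: "G integrable_on K"
  proof -
    have "compact K" by (simp add: K_eq finite_imp_compact_convex_hull)
    then have "set_integrable lborel K G"
      unfolding set_integrable_def
      by (rule borel_integrable_compact) (use G continuous_on_subset in blast)
    then show ?thesis by (rule set_borel_integral_eq_integral)
  qed
  have inner: "integral K (\<lambda>x. G x \<bullet> v) = integral K G \<bullet> v" for v
    using integral_linear[OF Gint bounded_linear_inner_left, of v] by (simp add: o_def)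
  have area: "\<bar>signed_area2 a c b\<bar> = s"
    using signed_area2_swap[of a c b] by (simp add: s_def)
  have n_ab: "n a b \<bullet> (b - a) = 0" "dist a b * (n a b \<bullet> (c - a)) = - s"
    using outward_normal_triangle[OF nz] by (simp_all add: n_def K_eq s_def)
  have n_bc: "n b c \<bullet> (c - b) = 0" "dist b c * (n b c \<bullet> (a - b)) = - s"
    using outward_normal_triangle[of b c a] nz
    by (simp_all add: n_def K_eq s_def signed_area2_rotate insert_commute)
  have n_ca: "n c a \<bullet> (a - c) = 0" "dist c a * (n c a \<bullet> (b - c)) = - s"
    using outward_normal_triangle[of c a b] nz
    by (simp_all add: n_def K_eq s_def signed_area2_rotate[symmetric] insert_commute)
  have "integral K G \<bullet> (c - a) = s * (I c b - I a b)"
    using integral_triangle_directional[OF der G nz] inner[of "c - a"]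
    by (simp add: K_eq I_def s_def)
  moreover have "N \<bullet> (c - a) = s * (I c b - I a b)"
  proof -
    have "dist b c * (n b c \<bullet> (c - a)) = s" "n c a \<bullet> (c - a) = 0"
      using n_bc n_ca inner_diff_right[of "n b c" "c - b" "a - b"] inner_minus_right[of "n c a" "a - c"]
      by simp_all
    moreover have "N \<bullet> (c - a) = I a b * (dist a b * (n a b \<bullet> (c - a)))
      + I b c * (dist b c * (n b c \<bullet> (c - a))) + (dist c a * I c a) * (n c a \<bullet> (c - a))"
      by (simp add: N_def inner_add_left)
    ultimately show ?thesis
      by (simp only: n_ab(2) I_commute[of c b]) (simp add: right_diff_distrib mult.commute)
  qed
  moreover have "integral K G \<bullet> (b - a) = s * (I b c - I a c)"
  proof -
    have K': "K = convex hull {a, c, b}" by (simp only: K_eq insert_commute[of b c])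
    have nz': "signed_area2 a c b \<noteq> 0" using nz signed_area2_swap[of a c b] by linarith
    show ?thesis
      using integral_triangle_directional[OF der G nz'] unfolding K'[symmetric] area inner I_def .
  qed
  moreover have "N \<bullet> (b - a) = s * (I b c - I a c)"
  proof -
    have "dist b c * (n b c \<bullet> (b - a)) = s" "dist c a * (n c a \<bullet> (b - a)) = - s"
      using n_bc n_ca inner_minus_right[of "n b c" "a - b"] inner_diff_right[of "n c a" "b - c" "a - c"]
      by simp_all
    moreover have "N \<bullet> (b - a) = (dist a b * I a b) * (n a b \<bullet> (b - a))
      + I b c * (dist b c * (n b c \<bullet> (b - a))) + I c a * (dist c a * (n c a \<bullet> (b - a)))"
      by (simp add: N_def inner_add_left)
    ultimately show ?thesis
      by (simp only: n_ab(1) I_commute[of c a]) (simp add: right_diff_distrib mult.commute)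
  qed
  ultimately have "(integral K G - N) \<bullet> (b - a) = 0" "(integral K G - N) \<bullet> (c - a) = 0"
    by (simp_all add: inner_diff_left)
  then have "integral K G - N = 0"
    using orthogonal_to_two_imp_zero nz unfolding signed_area2_def by blast
  then have "integral K G = N"
    by simp
  then have "integral K (\<lambda>x. L (G x)) = L N"
    using integral_linear[OF Gint lin] by (simp add: o_def)
  also have "\<dots> = (\<Sum>e | e edge_of K. edge_integral e (\<lambda>x. f x *\<^sub>R L (outward_normal K e)))"
  proof -
    have "{e. e edge_of K} = {closed_segment a b, closed_segment b c, closed_segment c a}"
      using edges_of_triangle C abc by simp
    moreover have "closed_segment a b \<noteq> closed_segment b c" "closed_segment a b \<noteq> closed_segment c a"
      "closed_segment b c \<noteq> closed_segment c a"
      using ne by (auto simp: doubleton_eq_iff)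
    ultimately show ?thesis
      by (simp only: edge sum.insert finite.intros insert_iff empty_iff simp_thms sum.empty)
         (simp add: N_def linear_add[OF L])
  qed
  finally show ?thesis .
qed

section \<open>Integrals and edges of the triangles of a mesh\<close>

lemma triangle_interior_nonempty:
  fixes K :: element
  assumes "2 simplex K"
  shows "interior K \<noteq> {}"
proof -
  have "aff_dim K = 2" "convex K"
    using assms aff_dim_simplex convex_simplex by auto
  then have "interior K = rel_interior K" "K \<noteq> {}"
    by (auto simp: interior_rel_interior_gen)
  then show ?thesis
    using rel_interior_eq_empty \<open>convex K\<close> by metis
qed

lemma closure_interior_triangle:
  fixes K :: element
  assumes "2 simplex K"
  shows "closure (interior K) = K"
  using triangle_interior_nonempty[OF assms] convex_closure_interior convex_simplex[OF assms]
    closed_simplex[OF assms] closure_closed by metis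

lemma integrable_on_simplex:
  fixes f :: "point \<Rightarrow> 'b::euclidean_space"
  assumes "n simplex K" "continuous_on UNIV f"
  shows "f integrable_on K"
proof -
  have "set_integrable lborel K f"
    unfolding set_integrable_def
    by (rule borel_integrable_compact) (use assms compact_simplex continuous_on_subset in blast)+
  then show ?thesis by (rule set_borel_integral_eq_integral)
qed

text \<open>A continuous function with vanishing \<open>L\<^sup>2\<close> norm is zero in the interior, which is dense in
  the triangle.\<close>
lemma integral_square_eq_0_imp_0:
  fixes d :: "point \<Rightarrow> real"
  assumes K: "2 simplex K" and d: "continuous_on UNIV d" and 0: "integral K (\<lambda>x. d x * d x) = 0"
    and x: "x \<in> K"
  shows "d x = 0"
proof -
  have d2: "continuous_on S (\<lambda>x. d x * d x)" for S
    using d by (intro continuous_intros) (auto intro: continuous_on_subset)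
  have "d y = 0" if y: "y \<in> interior K" for y
  proof -
    obtain a b where ab: "y \<in> box a b" "cbox a b \<subseteq> interior K"
      using open_contains_cbox[OF open_interior y] by metis
    have "integral (cbox a b) (\<lambda>x. d x * d x) \<le> integral K (\<lambda>x. d x * d x)"
      using ab(2) interior_subset integrable_on_simplex[OF K d2]
      by (intro integral_subset_le integrable_continuous d2) auto
    moreover have "0 \<le> integral (cbox a b) (\<lambda>x. d x * d x)"
      by (intro integral_nonneg integrable_continuous d2) auto
    ultimately have "((\<lambda>x. d x * d x) has_integral 0) (cbox a b)"
      using 0 integrable_integral[OF integrable_continuous[OF d2[of "cbox a b"]]] by simp
    then have "d y * d y = 0"
      using ab(1) box_subset_cbox by (intro has_integral_0_cbox_imp_0[OF d2]) auto
    then show ?thesis by simp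
  qed
  moreover have "continuous_on (closure (interior K)) d"
    using d continuous_on_subset by blast
  ultimately show ?thesis
    using continuous_constant_on_closure[of "interior K" d 0 x] x closure_interior_triangle[OF K] by simp
qed

lemma edge_is_segment:
  fixes e :: "point set"
  assumes "e edge_of K" "2 simplex K"
  obtains a b where "e = closed_segment a b"
proof -
  obtain C where C: "\<not> affine_dependent C" "card C = 3" "K = convex hull C"
    using assms(2) by (auto simp: simplex_def)
  then obtain a b c where "C = {a, b, c}"
    by (auto simp: card_3_iff)
  then have "e \<in> {closed_segment a b, closed_segment b c, closed_segment c a}"
    using edges_of_triangle[of a b c] C assms(1) by auto
  then show ?thesis using that by auto
qed

lemma edge_integral_cong:
  assumes "e = closed_segment a b" "\<And>x. x \<in> e \<Longrightarrow> f x = f' x"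
  shows "edge_integral e f = edge_integral e f'"
  unfolding assms(1) edge_integral_segment
  using assms by (auto intro!: integral_cong arg_cong[where f="\<lambda>z. dist a b *\<^sub>R z"] simp: linepath_in_path)

text \<open>Let \<open>z\<close> be a point of the domain in the relative interior of \<open>e\<close>. It is not an interior point
  of \<open>K\<close>, hence the other triangles, whose union is closed, must contain it. As the mesh is
  conforming, any other triangle \<open>K'\<close> that contains \<open>z\<close> meets \<open>K\<close> in a common face; this face contains
  \<open>e\<close> and has dimension at most one, so it is \<open>e\<close>.\<close>
lemma neighbour_exists:
  assumes mesh: "triangular_mesh \<Omega> T" and K: "K \<in> T" and e: "e edge_of K" and nf: "\<not> e \<subseteq> frontier \<Omega>"
  shows "\<exists>K'. K' \<in> T \<and> K' \<noteq> K \<and> e edge_of K'"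
proof -
  have T: "finite T" "\<And>K K'. K \<in> T \<Longrightarrow> K' \<in> T \<Longrightarrow> (K \<inter> K') face_of K"
    and s: "\<And>K. K \<in> T \<Longrightarrow> 2 simplex K" and un: "\<Union>T = closure \<Omega>" and op: "open \<Omega>"
    using mesh by (auto simp: triangular_mesh_def triangulation_def)
  have eK: "e face_of K" "aff_dim e = 1" using e by (auto simp: edge_of_def)
  have conv: "convex K" "convex e"
    using s[OF K] convex_simplex eK face_of_imp_convex by auto
  have dimK: "aff_dim K' = 2" if "K' \<in> T" for K'
    using s[OF that] aff_dim_simplex by blast
  obtain x where x: "x \<in> e" "x \<notin> frontier \<Omega>" using nf by blast
  have "x \<in> closure \<Omega>" using x(1) eK K un face_of_imp_subset by blast
  then have x\<Omega>: "x \<in> \<Omega>"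
    using x(2) op by (simp add: frontier_def interior_open)
  have "x \<in> closure (rel_interior e)"
    using x(1) convex_closure_rel_interior[OF conv(2)] closure_subset by blast
  then obtain z where z: "z \<in> rel_interior e" "z \<in> \<Omega>"
    using op x\<Omega> by (metis disjoint_iff open_Int_closure_eq_empty IntI empty_iff)
  have "e \<noteq> K" using eK(2) dimK[OF K] by auto
  then have zfr: "z \<notin> interior K"
    using face_of_disjoint_interior[OF eK(1)] z(1) rel_interior_subset by blast
  define R where "R = \<Union>(T - {K})"
  have "closed R"
    unfolding R_def using T(1) s closed_simplex by (intro closed_Union) auto
  have "z \<in> R"
  proof (rule ccontr)
    assume "z \<notin> R"
    then have "open (\<Omega> - R)" "z \<in> \<Omega> - R"
      using op \<open>closed R\<close> z by auto
    moreover have "\<Omega> - R \<subseteq> K"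
      using un closure_subset unfolding R_def by fastforce
    ultimately have "z \<in> interior K"
      by (meson interior_maximal subsetD)
    then show False using zfr by blast
  qed
  then obtain K' where K': "K' \<in> T" "K' \<noteq> K" "z \<in> K'" unfolding R_def by blast
  define F where "F = K \<inter> K'"
  have FK: "F face_of K" "F face_of K'"
    using T(2)[OF K K'(1)] T(2)[OF K'(1) K] by (auto simp: F_def Int_commute)
  have "e \<subseteq> K" using eK(1) face_of_imp_subset by blast
  then have eF: "e \<subseteq> F"
    using FK(1) z(1) K'(3) rel_interior_subset[of e]
    by (intro subset_of_face_of[of F K]) (auto simp: F_def)
  have convK': "convex K'" using s[OF K'(1)] convex_simplex by blast
  have "F \<noteq> K'"
  proof
    assume "F = K'"
    then have "K' face_of K" using FK by simp
    then show False
      using face_of_aff_dim_lt[OF conv(1)] K' dimK[OF K] dimK[OF K'(1)] by fastforce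
  qed
  then have "aff_dim F < 2"
    using face_of_aff_dim_lt[OF convK' FK(2)] dimK[OF K'(1)] by simp
  moreover have "e face_of F"
    using face_of_subset[OF eK(1) eF] FK(1) face_of_imp_subset by blast
  moreover have "convex F" using FK(1) face_of_imp_convex by blast
  ultimately have "e = F"
    using face_of_aff_dim_lt[of F e] eK(2) by force
  then show ?thesis
    using FK(2) eK(2) K' by (auto simp: edge_of_def)
qed

section \<open>Polynomials in two variables\<close>

lemma grad_eqI:
  assumes "(f has_derivative (\<lambda>v. G \<bullet> v)) (at x)"
  shows "grad f x = G"
  unfolding grad_def frechet_derivative_at[OF assms, symmetric] by (simp add: vec_eq_iff inner_axis)

lemma polynomial_differentiable:
  assumes "p \<in> polynomials_upto k"
  shows "\<And>x. (p has_derivative (\<lambda>v. grad p x \<bullet> v)) (at x)" and "continuous_on UNIV (grad p)"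
proof -
  obtain c :: "nat \<Rightarrow> nat \<Rightarrow> real"
    where p: "p = (\<lambda>x. \<Sum>i\<le>k. \<Sum>j\<le>k - i. c i j * (x $ 1) ^ i * (x $ 2) ^ j)"
    using assms by (auto simp: polynomials_upto_def)
  define G :: "point \<Rightarrow> real^2" where "G = (\<lambda>x. \<Sum>i\<le>k. \<Sum>j\<le>k - i.
     (c i j * (real i * (x $ 1) ^ (i - 1)) * (x $ 2) ^ j) *\<^sub>R axis 1 1
     + (c i j * (x $ 1) ^ i * (real j * (x $ 2) ^ (j - 1))) *\<^sub>R axis 2 1)"
  have mono: "((\<lambda>x :: point. c i j * (x $ 1) ^ i * (x $ 2) ^ j) has_derivative
      (\<lambda>v. ((c i j * (real i * (x $ 1) ^ (i - 1)) * (x $ 2) ^ j) *\<^sub>R axis 1 1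
     + (c i j * (x $ 1) ^ i * (real j * (x $ 2) ^ (j - 1))) *\<^sub>R axis 2 1) \<bullet> v)) (at x)" for i j x
    by (auto intro!: derivative_eq_intros bounded_linear_imp_has_derivative bounded_linear_vec_nth
        simp: inner_add_left inner_axis' algebra_simps)
  have der: "(p has_derivative (\<lambda>v. G x \<bullet> v)) (at x)" for x
    unfolding p G_def inner_sum_left by (intro has_derivative_sum mono)
  then have "grad p = G"
    using grad_eqI by blast
  then show "\<And>x. (p has_derivative (\<lambda>v. grad p x \<bullet> v)) (at x)" "continuous_on UNIV (grad p)"
    using der by (auto simp: G_def intro!: continuous_intros)
qed

lemma polynomial_continuous: "p \<in> polynomials_upto k \<Longrightarrow> continuous_on S p"
  using polynomial_differentiable(1) has_derivative_continuous_on has_derivative_at_withinI by meson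

lemma polynomials_upto_diff:
  assumes "p \<in> polynomials_upto k" "q \<in> polynomials_upto k"
  shows "(\<lambda>x. p x - q x) \<in> polynomials_upto k"
proof -
  obtain c d :: "nat \<Rightarrow> nat \<Rightarrow> real"
    where "\<And>x. p x = (\<Sum>i\<le>k. \<Sum>j\<le>k - i. c i j * (x $ 1) ^ i * (x $ 2) ^ j)"
      and "\<And>x. q x = (\<Sum>i\<le>k. \<Sum>j\<le>k - i. d i j * (x $ 1) ^ i * (x $ 2) ^ j)"
    using assms unfolding polynomials_upto_def by blast
  then have "p x - q x = (\<Sum>i\<le>k. \<Sum>j\<le>k - i. (c i j - d i j) * (x $ 1) ^ i * (x $ 2) ^ j)" for x
    by (simp add: sum_subtractf left_diff_distrib)
  then show ?thesis
    unfolding polynomials_upto_def by (intro CollectI exI[of _ "\<lambda>i j. c i j - d i j"]) simp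
qed

section \<open>The Ripa system at rest\<close>

lemma vector_4 [simp]:
  "(vector [a, b, c, d] :: 'a::zero^4) $ 1 = a"
  "(vector [a, b, c, d] :: 'a^4) $ 2 = b"
  "(vector [a, b, c, d] :: 'a^4) $ 3 = c"
  "(vector [a, b, c, d] :: 'a^4) $ 4 = d"
  unfolding vector_def by simp_all

text \<open>At rest only the two momentum equations are nontrivial.\<close>
definition momentum_part :: "real^2 \<Rightarrow> state" where
  "momentum_part v = vector [0, v $ 1, v $ 2, 0]"

lemma linear_momentum_part: "linear momentum_part"
  by (rule linearI) (simp_all add: momentum_part_def vec_eq_iff forall_4)

lemma ripa_flux_at_rest:
  assumes "U $ 2 = 0" "U $ 3 = 0" "U $ 4 = C1 * U $ 1"
  shows "ripa_flux g \<theta>\<^sub>0 U *v n = momentum_part ((g * C1 * (U $ 1)\<^sup>2 / 2) *\<^sub>R n)"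
  using assms
  by (simp add: ripa_flux_def Let_def momentum_part_def vec_eq_iff forall_4 matrix_vector_mult_def sum_2
      vel_x_def vel_y_def power2_eq_square)

lemma ripa_source_at_rest:
  assumes "U $ 4 = C1 * U $ 1"
  shows "ripa_source g U db = momentum_part ((- g * C1 * U $ 1) *\<^sub>R db)"
  using assms by (simp add: ripa_source_def momentum_part_def vec_eq_iff forall_4)

text \<open>Only the sum of depth and bottom enters, so the result is the same on both sides of an edge.
  A dry state has temperature \<open>C1\<close> by convention.\<close>
lemma reconstruct_at_rest:
  assumes "lake_at_rest_state C1 C2 U b"
  shows "reconstruct C1 U b bstar = max 0 (C2 - bstar) *\<^sub>R vector [1, 0, 0, C1]"
  using assms
  by (auto simp: reconstruct_def lake_at_rest_state_def vel_x_def vel_y_def temp_def)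

text \<open>Both reconstructed states equal \<open>V\<close>, so the numerical flux is the exact flux at \<open>V\<close>, and
  this is what the correction term subtracts.\<close>
lemma modified_flux_at_rest:
  assumes U: "lake_at_rest_state C1 C2 (U K x) (b K x)"
    and ext: "exterior_values \<Omega> T bt U b K e x = (Ue, be)" "lake_at_rest_state C1 C2 Ue be"
  shows "modified_flux var g C1 \<Omega> T bt U b K e x = ripa_flux g C1 (U K x) *v outward_normal K e"
proof -
  have "reconstructed_values C1 \<Omega> T bt U b K e x = (V, V)"
    if "V = max 0 (C2 - max (b K x) be) *\<^sub>R vector [1, 0, 0, C1]" for V
    using that reconstruct_at_rest[OF U] reconstruct_at_rest[OF ext(2)]
    by (simp add: reconstructed_values_def ext(1) Let_def)
  then show ?thesis
    by (simp add: modified_flux_def lax_friedrichs_def Let_def matrix_vector_mult_diff_rdistrib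
        matrix_vector_mult_add_rdistrib)
qed

lemma exterior_values_at_rest:
  assumes mesh: "triangular_mesh \<Omega> T" and K: "K \<in> T" and e: "e edge_of K" and x: "x \<in> e"
    and U: "U \<in> dg_space4 k T" and lake: "lake_at_rest C1 C2 T U b"
    and bwb: "boundary_well_balanced C1 C2 k \<Omega> T bt b"
  obtains Ue be where "exterior_values \<Omega> T bt U b K e x = (Ue, be)" "lake_at_rest_state C1 C2 Ue be"
proof (cases "e \<subseteq> frontier \<Omega>")
  case True
  then show ?thesis
    using bwb U lake K e x that[of "fst (bt U b K e x)" "snd (bt U b K e x)"]
    by (auto simp: boundary_well_balanced_def exterior_values_def)
next
  case False
  let ?N = "neighbour T K e"
  have N: "?N \<in> T" "e edge_of ?N"
    using someI_ex[OF neighbour_exists[OF mesh K e False]] unfolding neighbour_def by auto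
  then have "x \<in> ?N" using x edge_of_imp_subset by blast
  then show ?thesis
    using that[of "U ?N x" "b ?N x"] False lake N(1) by (auto simp: exterior_values_def lake_at_rest_def)
qed

text \<open>All three parts are expressed by the product \<open>P\<close> of test function and pressure: the volume
  terms give its gradient \<open>G\<close>, the edge terms its normal trace.\<close>
lemma residual_at_rest:
  assumes mesh: "triangular_mesh \<Omega> T" and K: "K \<in> T"
    and U: "U \<in> dg_space4 k T" and b: "b \<in> dg_space k T" and lake: "lake_at_rest C1 C2 T U b"
    and bwb: "boundary_well_balanced C1 C2 k \<Omega> T bt b" and \<phi>: "\<phi> \<in> dg_space k T"
  shows "residual var g C1 \<Omega> T bt K U b \<phi> = 0"
proof -
  have simplex: "2 simplex K" using mesh K by (simp add: triangular_mesh_def)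
  define h where "h = (\<lambda>x. U K x $ 1)"
  define p where "p = \<phi> K"
  define P where "P = (\<lambda>x. p x * (g * C1 * (h x)\<^sup>2 / 2))"
  define G where "G = (\<lambda>x. (p x * (g * C1 * h x)) *\<^sub>R grad h x + (g * C1 * (h x)\<^sup>2 / 2) *\<^sub>R grad p x)"
  have h_poly: "h \<in> polynomials_upto k"
    using U K by (auto simp: dg_space4_def dg_space_def h_def)
  have p_poly: "p \<in> polynomials_upto k"
    using \<phi> K by (auto simp: dg_space_def p_def)
  have b_poly: "b K \<in> polynomials_upto k"
    using b K by (auto simp: dg_space_def)
  note h_der = polynomial_differentiable[OF h_poly] polynomial_continuous[OF h_poly]
  note p_der = polynomial_differentiable[OF p_poly] polynomial_continuous[OF p_poly]
  have at_rest: "lake_at_rest_state C1 C2 (U K x) (b K x)" if "x \<in> K" for x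
    using lake K that by (auto simp: lake_at_rest_def)
  have P_der: "(P has_derivative (\<lambda>v. G x \<bullet> v)) (at x)" for x
  proof -
    have "((\<lambda>x. p x * ((g * C1 / 2) * (h x * h x))) has_derivative
        (\<lambda>v. p x * ((g * C1 / 2) * (h x * (grad h x \<bullet> v) + (grad h x \<bullet> v) * h x))
          + (grad p x \<bullet> v) * ((g * C1 / 2) * (h x * h x)))) (at x)"
      by (intro has_derivative_mult has_derivative_mult_right p_der(1) h_der(1))
    then show ?thesis
      by (simp add: P_def G_def inner_add_left power2_eq_square algebra_simps)
  qed
  have flux: "ripa_flux g C1 (U K x) *v n = momentum_part ((g * C1 * (h x)\<^sup>2 / 2) *\<^sub>R n)" if "x \<in> K" for x n
    using ripa_flux_at_rest[of "U K x" C1] at_rest[OF that] by (simp add: lake_at_rest_state_def h_def)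
  \<comment> \<open>The relation \<open>b = C2 - h\<close> holds on \<open>K\<close> only, so it may be differentiated in the interior.\<close>
  have grad_b: "grad (b K) x = - grad h x" if x: "x \<in> interior K" for x
  proof (rule grad_eqI)
    have "((\<lambda>x. C2 - h x) has_derivative (\<lambda>v. - grad h x \<bullet> v)) (at x)"
      by (auto intro!: derivative_eq_intros h_der(1))
    then show "(b K has_derivative (\<lambda>v. - grad h x \<bullet> v)) (at x)"
    proof (rule has_derivative_transform_within_open[OF _ open_interior x])
      fix y assume "y \<in> interior K"
      then have "h y + b K y = C2"
        using at_rest interior_subset by (auto simp: lake_at_rest_state_def h_def)
      then show "C2 - h y = b K y" by simp
    qed
  qed
  have linb: "bounded_linear momentum_part"
    using linear_momentum_part linear_conv_bounded_linear by blast
  note cont_mp = bounded_linear.continuous_on[OF linb]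
  have "integral K (\<lambda>x. \<phi> K x *\<^sub>R ripa_source g (U K x) (grad (b K) x))
      = integral K (\<lambda>x. momentum_part ((p x * (g * C1 * h x)) *\<^sub>R grad h x))"
  proof (rule integral_spike)
    show "negligible (frontier K)"
      using negligible_convex_frontier convex_simplex simplex by blast
    fix x assume "x \<in> K - frontier K"
    then have "x \<in> interior K" "x \<in> K"
      using closure_subset by (auto simp: frontier_def)
    then have "ripa_source g (U K x) (grad (b K) x) = momentum_part ((g * C1 * h x) *\<^sub>R grad h x)"
      using ripa_source_at_rest[of "U K x" C1] at_rest[of x]
      by (simp add: grad_b lake_at_rest_state_def h_def)
    then show "momentum_part ((p x * (g * C1 * h x)) *\<^sub>R grad h x)
        = \<phi> K x *\<^sub>R ripa_source g (U K x) (grad (b K) x)"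
      by (simp add: p_def linear_scale[OF linear_momentum_part] mult.assoc)
  qed
  moreover have "integral K (\<lambda>x. ripa_flux g C1 (U K x) *v grad (\<phi> K) x)
      = integral K (\<lambda>x. momentum_part ((g * C1 * (h x)\<^sup>2 / 2) *\<^sub>R grad p x))"
    by (intro integral_cong) (simp add: flux p_def)
  moreover have "integral K (\<lambda>x. momentum_part ((p x * (g * C1 * h x)) *\<^sub>R grad h x))
      + integral K (\<lambda>x. momentum_part ((g * C1 * (h x)\<^sup>2 / 2) *\<^sub>R grad p x))
      = integral K (\<lambda>x. momentum_part (G x))"
    unfolding G_def linear_add[OF linear_momentum_part]
    by (intro integral_add[symmetric] integrable_on_simplex[OF simplex] cont_mp continuous_intros
        h_der p_der) simp_all
  moreover have "integral K (\<lambda>x. momentum_part (G x))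
      = (\<Sum>e | e edge_of K. edge_integral e (\<lambda>x. P x *\<^sub>R momentum_part (outward_normal K e)))"
    using P_der linear_momentum_part simplex
    by (intro divergence_triangle) (auto simp: G_def intro!: continuous_intros h_der p_der)
  moreover have "edge_integral e (\<lambda>x. \<phi> K x *\<^sub>R modified_flux var g C1 \<Omega> T bt U b K e x)
      = edge_integral e (\<lambda>x. P x *\<^sub>R momentum_part (outward_normal K e))" if e: "e edge_of K" for e
  proof -
    obtain a c where "e = closed_segment a c"
      using edge_is_segment[OF e simplex] .
    then show ?thesis
    proof (rule edge_integral_cong)
      fix x assume x: "x \<in> e"
      then have xK: "x \<in> K" using e edge_of_imp_subset by blast
      obtain Ue be where "exterior_values \<Omega> T bt U b K e x = (Ue, be)" "lake_at_rest_state C1 C2 Ue be"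
        using exterior_values_at_rest[OF mesh K e x U lake bwb] .
      then have "modified_flux var g C1 \<Omega> T bt U b K e x = ripa_flux g C1 (U K x) *v outward_normal K e"
        by (rule modified_flux_at_rest[where U = U and K = K and b = b, OF at_rest[OF xK]])
      then show "\<phi> K x *\<^sub>R modified_flux var g C1 \<Omega> T bt U b K e x = P x *\<^sub>R momentum_part (outward_normal K e)"
        by (simp add: flux[OF xK] P_def p_def linear_scale[OF linear_momentum_part])
    qed
  qed
  ultimately show ?thesis
    by (simp add: residual_def)
qed

section \<open>Well-balance of the Runge-Kutta scheme\<close>

text \<open>The difference of the two functions is itself a test function, componentwise.\<close>
lemma moments_determine:
  assumes mesh: "triangular_mesh \<Omega> T" and U: "U \<in> dg_space4 k T" and V: "V \<in> dg_space4 k T"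
    and eq: "\<And>K \<phi>. K \<in> T \<Longrightarrow> \<phi> \<in> dg_space k T \<Longrightarrow> moment K U \<phi> = moment K V \<phi>"
    and K: "K \<in> T" and x: "x \<in> K"
  shows "U K x = V K x"
proof -
  have simplex: "2 simplex K" using mesh K by (simp add: triangular_mesh_def)
  have cont: "continuous_on UNIV (W K)" if "W \<in> dg_space4 k T" for W
  proof -
    have "continuous_on UNIV (\<lambda>x. \<chi> i. W K x $ i)"
      using that K by (intro continuous_on_vec_lambda polynomial_continuous[where k=k])
        (auto simp: dg_space4_def dg_space_def)
    then show ?thesis by simp
  qed
  have "U K x $ i - V K x $ i = 0" for i
  proof -
    define \<phi> where "\<phi> = (\<lambda>K x. U K x $ i - V K x $ i)"
    have \<phi>: "\<phi> \<in> dg_space k T"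
      using U V by (auto simp: \<phi>_def dg_space4_def dg_space_def intro!: polynomials_upto_diff)
    then have c\<phi>: "continuous_on UNIV (\<phi> K)"
      using K polynomial_continuous by (auto simp: dg_space_def)
    have mom: "moment K W \<phi> $ i = integral K (\<lambda>x. \<phi> K x * W K x $ i)"
      and int: "(\<lambda>x. \<phi> K x * W K x $ i) integrable_on K" if "W \<in> dg_space4 k T" for W
    proof -
      have "(\<lambda>x. \<phi> K x *\<^sub>R W K x) integrable_on K"
        by (intro integrable_on_simplex[OF simplex] continuous_intros c\<phi> cont[OF that])
      then show "moment K W \<phi> $ i = integral K (\<lambda>x. \<phi> K x * W K x $ i)"
        unfolding moment_def by (simp add: integral_component_eq_cart [symmetric])
      show "(\<lambda>x. \<phi> K x * W K x $ i) integrable_on K"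
        by (intro integrable_on_simplex[OF simplex] continuous_intros c\<phi> cont[OF that])
    qed
    have "integral K (\<lambda>x. \<phi> K x * \<phi> K x)
        = integral K (\<lambda>x. \<phi> K x * U K x $ i - \<phi> K x * V K x $ i)"
      by (simp add: \<phi>_def algebra_simps)
    also have "\<dots> = moment K U \<phi> $ i - moment K V \<phi> $ i"
      by (simp add: integral_diff int U V mom)
    also have "\<dots> = 0" using eq[OF K \<phi>] by simp
    finally have "\<phi> K x = 0"
      using integral_square_eq_0_imp_0[OF simplex c\<phi> _ x] by blast
    then show ?thesis by (simp add: \<phi>_def)
  qed
  then show ?thesis by (simp add: vec_eq_iff)
qed

theorem mainTheorem2:
  fixes g C1 C2 :: real and k n :: nat and t :: "nat \<Rightarrow> real"
    and \<Omega> :: "point set" and Told T :: "element set"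
    and var :: lf_variant and bt :: boundary_treatment
    and interp :: "dg_state \<Rightarrow> dg_state"
    and bold b :: dg_scalar
    and Uold Ut U1 U2 Unew :: dg_state
    and \<Delta>t :: real
  assumes "g > 0" and "C1 > 0" and "C2 > 0" and "k \<ge> 1"
    and "\<Delta>t = t (Suc n) - t n"
    and "triangular_mesh \<Omega> Told" and "triangular_mesh \<Omega> T"
    and "bold \<in> dg_space k Told" and "Uold \<in> dg_space4 k Told"
    and "lake_at_rest C1 C2 Told Uold bold"
    and "b \<in> dg_space k T"
    and "Ut = interp Uold" and "Ut \<in> dg_space4 k T"
    and "lake_at_rest C1 C2 T Ut b"
    and "boundary_well_balanced C1 C2 k \<Omega> T bt b"
    and "U1 \<in> dg_space4 k T" and "U2 \<in> dg_space4 k T" and "Unew \<in> dg_space4 k T"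
    and "\<forall>K\<in>T. \<forall>\<phi>\<in>dg_space k T.
           moment K U1 \<phi> = moment K Ut \<phi> + \<Delta>t *\<^sub>R residual var g C1 \<Omega> T bt K Ut b \<phi>"
    and "\<forall>K\<in>T. \<forall>\<phi>\<in>dg_space k T.
           moment K U2 \<phi> = (3/4) *\<^sub>R moment K Ut \<phi>
             + (1/4) *\<^sub>R (moment K U1 \<phi> + \<Delta>t *\<^sub>R residual var g C1 \<Omega> T bt K U1 b \<phi>)"
    and "\<forall>K\<in>T. \<forall>\<phi>\<in>dg_space k T.
           moment K Unew \<phi> = (1/3) *\<^sub>R moment K Ut \<phi>
             + (2/3) *\<^sub>R (moment K U2 \<phi> + \<Delta>t *\<^sub>R residual var g C1 \<Omega> T bt K U2 b \<phi>)"
  shows "(\<forall>K\<in>T. \<forall>x\<in>K. Unew K x = U2 K x \<and> U2 K x = U1 K x \<and> U1 K x = Ut K x)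
         \<and> lake_at_rest C1 C2 T Unew b"
proof -
  note mesh = \<open>triangular_mesh \<Omega> T\<close> and Ut = \<open>Ut \<in> dg_space4 k T\<close> and rest = \<open>lake_at_rest C1 C2 T Ut b\<close>
  have residual_0: "residual var g C1 \<Omega> T bt K U b \<phi> = 0"
    if "K \<in> T" "\<phi> \<in> dg_space k T" "U \<in> dg_space4 k T" "lake_at_rest C1 C2 T U b" for K \<phi> U
    using residual_at_rest[OF mesh that(1,3) _ that(4) _ that(2)] assms(11,15) by blast
  have stage: "(\<forall>K\<in>T. \<forall>x\<in>K. U K x = Ut K x) \<and> lake_at_rest C1 C2 T U b"
    if "U \<in> dg_space4 k T"
      and "\<And>K \<phi>. K \<in> T \<Longrightarrow> \<phi> \<in> dg_space k T \<Longrightarrow> moment K U \<phi> = moment K Ut \<phi>" for U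
    using moments_determine[OF mesh that(1) Ut that(2)] rest by (simp add: lake_at_rest_def)
  have m1: "moment K U1 \<phi> = moment K Ut \<phi>" if "K \<in> T" "\<phi> \<in> dg_space k T" for K \<phi>
    using assms(19) residual_0[OF that Ut rest] that by simp
  note U1 = stage[OF \<open>U1 \<in> dg_space4 k T\<close> m1]
  have m2: "moment K U2 \<phi> = moment K Ut \<phi>" if "K \<in> T" "\<phi> \<in> dg_space k T" for K \<phi>
    using assms(20) residual_0[OF that \<open>U1 \<in> dg_space4 k T\<close>] U1 m1[OF that] that
    by (simp add: scaleR_left_distrib[symmetric])
  note U2 = stage[OF \<open>U2 \<in> dg_space4 k T\<close> m2]
  have m3: "moment K Unew \<phi> = moment K Ut \<phi>" if "K \<in> T" "\<phi> \<in> dg_space k T" for K \<phi>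
    using assms(21) residual_0[OF that \<open>U2 \<in> dg_space4 k T\<close>] U2 m2[OF that] that
    by (simp add: scaleR_left_distrib[symmetric])
  note Unew = stage[OF \<open>Unew \<in> dg_space4 k T\<close> m3]
  show ?thesis using U1 U2 Unew by simp
qed

end
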